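(* Consider a knockout tournament starting with $n=2^\ell$ players of equal strength, where player $i$ defeats player $j$, independently of all other duels, with probability $1/2$ for all $1\le i\neq j\le n$; the winner of a duel continues to a duel with another winner, and the defeated player is eliminated from the tournament. Assume that the draw (schedule of the matches) is non-random. Let $S_i$ denote the number of games won by player $i$. Then the vector ${\bf S}=(S_1,\ldots,S_n)$ is negatively orthant dependent.
   Context: In a knockout tournament with $2^\ell$ players there are $\ell$ rounds; in each round the remaining players are paired, each pair plays one duel, the losers are eliminated and the winners proceed to the next round, until one champion remains after round $\ell$. A non-random draw means that the tournament bracket is a given, fixed one: the pairing of players in the first round is deterministic, and in every later round it is fixed in advance which matches' winners meet each other. A random vector ${\bf S}=(S_1,\ldots,S_n)$ is negatively orthant dependent (NOD) if for all $s_1,\ldots,s_n\in\mathbb{R}$ both $$P(S_1\le s_1,\ldots,S_n\le s_n)\le P(S_1\le s_1)\cdots P(S_n\le s_n)$$ and $$P(S_1>s_1,\ldots,S_n>s_n)\le P(S_1>s_1)\cdots P(S_n>s_n).$$ *)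

theory Defs
  imports "HOL-Probability.Probability"
begin

text \<open>
  A fixed draw is a binary tree: a leaf is a player entering the first round, and in
  \<open>Match a b\<close> the winner of \<open>a\<close> meets the winner of \<open>b\<close>. The order of the two
  subtrees carries no information once duel outcomes are antisymmetric.
\<close>

datatype bracket = Player nat | Match bracket bracket

primrec entrants :: "bracket \<Rightarrow> nat list" where
  "entrants (Player i) = [i]"
| "entrants (Match a b) = entrants a @ entrants b"

fun has_rounds :: "nat \<Rightarrow> bracket \<Rightarrow> bool" where
  "has_rounds 0 (Player i) = True"
| "has_rounds (Suc k) (Match a b) = (has_rounds k a \<and> has_rounds k b)"
| "has_rounds _ _ = False"

text \<open>Each of the players \<open>1, \<dots>, 2 ^ l\<close> enters exactly once, and every path to the
  final has \<open>l\<close> rounds.\<close>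

definition knockout_draw :: "nat \<Rightarrow> bracket \<Rightarrow> bool" where
  "knockout_draw l b \<longleftrightarrow>
     has_rounds l b \<and> distinct (entrants b) \<and> set (entrants b) = {1..2 ^ l}"

text \<open>Below, \<open>d i j\<close> means that \<open>i\<close> defeats \<open>j\<close> if they meet.\<close>

primrec winner :: "(nat \<Rightarrow> nat \<Rightarrow> bool) \<Rightarrow> bracket \<Rightarrow> nat" where
  "winner d (Player i) = i"
| "winner d (Match a b) = (if d (winner d a) (winner d b) then winner d a else winner d b)"

primrec games_won :: "(nat \<Rightarrow> nat \<Rightarrow> bool) \<Rightarrow> bracket \<Rightarrow> nat \<Rightarrow> nat" where
  "games_won d (Player j) i = 0"
| "games_won d (Match a b) i =
     games_won d a i + games_won d b i + (if winner d (Match a b) = i then 1 else 0)"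

text \<open>
  Equal strengths: \<open>D i j\<close> is the event that \<open>i\<close> defeats \<open>j\<close>. A duel belongs to an
  unordered pair of players, so independence is required over the pairs with \<open>i < j\<close>;
  the outcome for \<open>(j, i)\<close> is the complement of that for \<open>(i, j)\<close>.
\<close>

definition fair_duels :: "'w measure \<Rightarrow> nat \<Rightarrow> (nat \<Rightarrow> nat \<Rightarrow> 'w \<Rightarrow> bool) \<Rightarrow> bool" where
  "fair_duels M n D \<longleftrightarrow>
     (\<forall>i\<in>{1..n}. \<forall>j\<in>{1..n}. i \<noteq> j \<longrightarrow>
        (\<forall>\<omega>\<in>space M. D j i \<omega> \<longleftrightarrow> \<not> D i j \<omega>) \<and>
        measure M {\<omega> \<in> space M. D i j \<omega>} = 1 / 2) \<and>
     prob_space.indep_vars M (\<lambda>_. count_space UNIV) (\<lambda>(i, j). D i j)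
       {(i, j). 1 \<le> i \<and> i < j \<and> j \<le> n}"

definition negatively_orthant_dependent ::
    "'w measure \<Rightarrow> 'i set \<Rightarrow> ('i \<Rightarrow> 'w \<Rightarrow> real) \<Rightarrow> bool" where
  "negatively_orthant_dependent M I S \<longleftrightarrow>
     (\<forall>i\<in>I. S i \<in> borel_measurable M) \<and>
     (\<forall>s :: 'i \<Rightarrow> real.
        measure M {\<omega> \<in> space M. \<forall>i\<in>I. S i \<omega> \<le> s i}
          \<le> (\<Prod>i\<in>I. measure M {\<omega> \<in> space M. S i \<omega> \<le> s i}) \<and>
        measure M {\<omega> \<in> space M. \<forall>i\<in>I. S i \<omega> > s i}
          \<le> (\<Prod>i\<in>I. measure M {\<omega> \<in> space M. S i \<omega> > s i}))"

end

theory Submission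
  imports Defs
begin

text \<open>
  Follow a sub-bracket \<open>t\<close> through the rest of the tournament. Its winner goes on to win a random
  number \<open>X\<close> of further games, independent of what happened inside \<open>t\<close>, so the final score of an
  entrant \<open>i\<close> of \<open>t\<close> is its score inside \<open>t\<close>, plus \<open>X\<close> if \<open>i\<close> is the winner of \<open>t\<close>. The statement
  that carries an induction over brackets is the product inequality
  \<open>E (\<Prod>i. \<phi> i (score i)) \<le> (\<Prod>i. E (\<phi> i (score i)))\<close>
  for these final scores, where the \<open>\<phi> i\<close> are nonnegative and all increasing or all decreasing.
  Indicators of half-lines then give the two orthant inequalities.

  For the induction step let \<open>t\<close> be the match of \<open>a\<close> against \<open>b\<close>, with a fair coin for its duel.
  The winner of \<open>a\<close> gains \<open>Y = 1 + X\<close> and the winner of \<open>b\<close> gains \<open>Z = 0\<close>, or the other way round.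
  Given \<open>Y\<close> and \<open>Z\<close> the two sides are independent, so the left-hand side is \<open>E (f Y * g Z)\<close>, where
  \<open>f\<close> and \<open>g\<close> are the conditional means of the two partial products; they are monotone in the same
  direction. Since one of \<open>Y\<close>, \<open>Z\<close> is always zero, \<open>(f Y - f 0) * (g Z - g 0) = 0\<close>, and therefore
  \<open>E (f Y * g Z) - E (f Y) * E (g Z) = - E (f Y - f 0) * E (g Z - g 0) \<le> 0\<close>.
  The induction hypothesis applies to \<open>a\<close> with gain \<open>Y\<close> and to \<open>b\<close> with gain \<open>Z\<close>.

  The gains that occur are truncated geometric variables, and the conditional means satisfy a
  recursion over the bracket. Hence the inequality is an inequality between recursively defined
  real numbers, \<open>mean_gain_score_mean_le_prod\<close>. Probability enters only through
  \<open>expectation_score_prod\<close>, which identifies these numbers with expectations. The duel between the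
  winners of two disjoint sub-brackets is a random choice among all duels, but once the two winners
  are specified it is a single duel, independent of everything inside the two sub-brackets.
\<close>

section \<open>The orthant inequality for the recursive score means\<close>

text \<open>
  The mean of \<open>f X\<close>, where \<open>X\<close> is the number of consecutive games, out of at most \<open>k\<close> fair ones,
  that a player wins before the first defeat.
\<close>

primrec mean_gain :: "nat \<Rightarrow> (nat \<Rightarrow> real) \<Rightarrow> real" where
  "mean_gain 0 f = f 0"
| "mean_gain (Suc k) f = (f 0 + mean_gain k (\<lambda>x. f (Suc x))) / 2"

text \<open>
  The mean of the product of \<open>\<phi> i (score i)\<close> over the entrants \<open>i\<close>, when the winner of the bracket
  is credited with \<open>x\<close> games on top of those won inside it. In a match, the winner of one half takes
  these \<open>x\<close> games and the match itself, and the winner of the other half takes nothing.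
\<close>

primrec score_mean :: "bracket \<Rightarrow> (nat \<Rightarrow> nat \<Rightarrow> real) \<Rightarrow> nat \<Rightarrow> real" where
  "score_mean (Player i) \<phi> x = \<phi> i x"
| "score_mean (Match a b) \<phi> x =
     (score_mean a \<phi> (Suc x) * score_mean b \<phi> 0 + score_mean a \<phi> 0 * score_mean b \<phi> (Suc x)) / 2"

lemma score_mean_Match_fun:
  "score_mean (Match a b) \<phi> = (\<lambda>x.
     (score_mean a \<phi> (Suc x) * score_mean b \<phi> 0 + score_mean a \<phi> 0 * score_mean b \<phi> (Suc x)) / 2)"
  by (simp add: fun_eq_iff)

text \<open>
  With all factors but the \<open>i\<close>-th replaced by the constant 1, the product mean becomes the marginal
  mean of player \<open>i\<close>, so marginals obey the same recursion as products.
\<close>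

abbreviation only :: "nat \<Rightarrow> (nat \<Rightarrow> nat \<Rightarrow> real) \<Rightarrow> nat \<Rightarrow> nat \<Rightarrow> real" where
  "only i \<phi> \<equiv> (\<lambda>j. if j = i then \<phi> j else (\<lambda>_. 1))"

lemma mean_gain_combine:
  "mean_gain k (\<lambda>x. (f x * c + d * g x) / 2) = (mean_gain k f * c + d * mean_gain k g) / 2"
  by (induction k arbitrary: f g) (auto simp: field_simps)

lemma mean_gain_mono:
  "(\<And>x. f x \<le> g x) \<Longrightarrow> mean_gain k f \<le> mean_gain k g"
  by (induction k arbitrary: f g) (auto intro!: add_mono divide_right_mono)

lemma mean_gain_const: "mean_gain k (\<lambda>_. c) = c"
  by (induction k) auto

lemma score_mean_nonneg:
  "(\<And>i m. 0 \<le> \<phi> i m) \<Longrightarrow> 0 \<le> score_mean t \<phi> x"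
  by (induction t arbitrary: x) auto

lemma mono_score_mean:
  assumes "\<And>i m. 0 \<le> \<phi> i m" "\<And>i. mono (\<phi> i)"
  shows "mono (score_mean t \<phi>)"
proof (induction t)
  case (Match a b)
  then show ?case
    by (auto simp: mono_def assms(1) score_mean_nonneg
        intro!: divide_right_mono add_mono mult_mono)
qed (use assms in \<open>auto simp: mono_def\<close>)

lemma antimono_score_mean:
  assumes "\<And>i m. 0 \<le> \<phi> i m" "\<And>i. antimono (\<phi> i)"
  shows "antimono (score_mean t \<phi>)"
proof (induction t)
  case (Match a b)
  then show ?case
    by (auto simp: antimono_def assms(1) score_mean_nonneg
        intro!: divide_right_mono add_mono mult_mono)
qed (use assms in \<open>auto simp: antimono_def\<close>)

lemma score_mean_only_absent:
  "i \<notin> set (entrants t) \<Longrightarrow> score_mean t (only i \<phi>) x = 1"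
  by (induction t arbitrary: x) auto

text \<open>
  The negative dependence itself. The number \<open>k\<close> of rounds still to come has to be arbitrary: from a
  match to its two halves it grows by one.
\<close>

theorem mean_gain_score_mean_le_prod:
  assumes nonneg: "\<And>i m. 0 \<le> \<phi> i m"
    and monotone: "(\<forall>i. mono (\<phi> i)) \<or> (\<forall>i. antimono (\<phi> i))"
    and "distinct (entrants t)"
  shows "mean_gain k (score_mean t \<phi>) \<le> (\<Prod>i\<in>set (entrants t). mean_gain k (score_mean t (only i \<phi>)))"
  using \<open>distinct (entrants t)\<close>
proof (induction t arbitrary: k)
  case (Player i)
  show ?case by simp
next
  case (Match a b)
  let ?a0 = "score_mean a \<phi> 0" and ?b0 = "score_mean b \<phi> 0"
  let ?A = "mean_gain k (\<lambda>x. score_mean a \<phi> (Suc x))"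
  let ?B = "mean_gain k (\<lambda>x. score_mean b \<phi> (Suc x))"
  have disj: "set (entrants a) \<inter> set (entrants b) = {}" using Match.prems by auto
  \<comment> \<open>An extra win moves the means of both halves in the same direction; the covariance of the two
    partial products is a quarter of the negative of this product.\<close>
  have sign: "0 \<le> (?a0 - ?A) * (?b0 - ?B)"
    using monotone
  proof
    assume "\<forall>i. mono (\<phi> i)"
    then have m: "mono (score_mean t \<phi>)" for t by (simp add: mono_score_mean nonneg)
    have "score_mean t \<phi> 0 \<le> mean_gain k (\<lambda>x. score_mean t \<phi> (Suc x))" for t
      using mean_gain_mono[of "\<lambda>_. score_mean t \<phi> 0" "\<lambda>x. score_mean t \<phi> (Suc x)" k] m
      by (simp add: mean_gain_const monoD)
    then show ?thesis by (intro mult_nonpos_nonpos) auto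
  next
    assume "\<forall>i. antimono (\<phi> i)"
    then have m: "antimono (score_mean t \<phi>)" for t by (simp add: antimono_score_mean nonneg)
    have "mean_gain k (\<lambda>x. score_mean t \<phi> (Suc x)) \<le> score_mean t \<phi> 0" for t
      using mean_gain_mono[of "\<lambda>x. score_mean t \<phi> (Suc x)" "\<lambda>_. score_mean t \<phi> 0" k] m
      by (simp add: mean_gain_const antimonoD)
    then show ?thesis by (intro mult_nonneg_nonneg) auto
  qed
  have gain_nonneg: "0 \<le> mean_gain j (score_mean t \<psi>)" if "\<And>i m. 0 \<le> \<psi> i m" for j t \<psi>
    using mean_gain_mono[of "\<lambda>_. 0" "score_mean t \<psi>" j] score_mean_nonneg[OF that]
    by (simp add: mean_gain_const)
  have "mean_gain k (score_mean (Match a b) \<phi>) = (?A * ?b0 + ?a0 * ?B) / 2"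
    by (simp only: score_mean_Match_fun mean_gain_combine)
  also have "\<dots> \<le> mean_gain (Suc k) (score_mean a \<phi>) * mean_gain (Suc k) (score_mean b \<phi>)"
    using sign by (simp add: field_simps)
  also have "\<dots> \<le> (\<Prod>i\<in>set (entrants a). mean_gain (Suc k) (score_mean a (only i \<phi>)))
      * (\<Prod>i\<in>set (entrants b). mean_gain (Suc k) (score_mean b (only i \<phi>)))"
    using Match nonneg
    by (intro mult_mono prod_nonneg ballI gain_nonneg) (auto simp del: mean_gain.simps)
  also have "(\<Prod>i\<in>set (entrants a). mean_gain (Suc k) (score_mean a (only i \<phi>)))
      = (\<Prod>i\<in>set (entrants a). mean_gain k (score_mean (Match a b) (only i \<phi>)))"
  proof (rule prod.cong[OF refl])
    fix i assume "i \<in> set (entrants a)"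
    then have "i \<notin> set (entrants b)" using disj by auto
    then show "mean_gain (Suc k) (score_mean a (only i \<phi>))
        = mean_gain k (score_mean (Match a b) (only i \<phi>))"
      using mean_gain_combine[of k "\<lambda>x. score_mean a (only i \<phi>) (Suc x)" 1
          "score_mean a (only i \<phi>) 0" "\<lambda>_. 1"]
      by (simp add: score_mean_Match_fun score_mean_only_absent mean_gain_const)
  qed
  also have "(\<Prod>i\<in>set (entrants b). mean_gain (Suc k) (score_mean b (only i \<phi>)))
      = (\<Prod>i\<in>set (entrants b). mean_gain k (score_mean (Match a b) (only i \<phi>)))"
  proof (rule prod.cong[OF refl])
    fix i assume "i \<in> set (entrants b)"
    then have "i \<notin> set (entrants a)" using disj by auto
    then show "mean_gain (Suc k) (score_mean b (only i \<phi>))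
        = mean_gain k (score_mean (Match a b) (only i \<phi>))"
      using mean_gain_combine[of k "\<lambda>_. 1" "score_mean b (only i \<phi>) 0" 1
          "\<lambda>x. score_mean b (only i \<phi>) (Suc x)"]
      by (simp add: score_mean_Match_fun score_mean_only_absent mean_gain_const)
  qed
  finally show ?case
    using disj by (simp only: entrants.simps set_append prod.union_disjoint finite_set)
qed

section \<open>Winners and scores for given duel outcomes\<close>

lemma winner_in_entrants: "winner d t \<in> set (entrants t)"
  by (induction t) auto

lemma games_won_outside: "i \<notin> set (entrants t) \<Longrightarrow> games_won d t i = 0"
  using winner_in_entrants[of d] by (induction t) (auto split: if_splits)

lemma winner_cong:
  assumes "distinct (entrants t)"
    and "\<And>i j. i \<in> set (entrants t) \<Longrightarrow> j \<in> set (entrants t) \<Longrightarrow> i \<noteq> j \<Longrightarrow> d i j = d' i j"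
  shows "winner d t = winner d' t"
  using assms
proof (induction t)
  case (Match a b)
  have "winner d a = winner d' a" "winner d b = winner d' b"
    using Match by auto
  moreover have "d (winner d' a) (winner d' b) = d' (winner d' a) (winner d' b)"
    using Match.prems winner_in_entrants[of d' a] winner_in_entrants[of d' b]
    by (intro Match.prems(2)) auto
  ultimately show ?case by simp
qed simp

lemma games_won_cong:
  assumes "distinct (entrants t)"
    and "\<And>i j. i \<in> set (entrants t) \<Longrightarrow> j \<in> set (entrants t) \<Longrightarrow> i \<noteq> j \<Longrightarrow> d i j = d' i j"
  shows "games_won d t = games_won d' t"
  using assms
proof (induction t)
  case (Match a b)
  have "games_won d a = games_won d' a" "games_won d b = games_won d' b"
    using Match by auto
  moreover have "winner d (Match a b) = winner d' (Match a b)"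
    using Match.prems by (intro winner_cong) auto
  ultimately show ?case by (auto simp del: winner.simps)
qed auto

text \<open>Here \<open>x\<close> is the number of games that the winner of the bracket wins after leaving it.\<close>

definition score :: "(nat \<Rightarrow> nat \<Rightarrow> bool) \<Rightarrow> bracket \<Rightarrow> nat \<Rightarrow> nat \<Rightarrow> nat" where
  "score d t x i = games_won d t i + (if winner d t = i then x else 0)"

definition score_prod ::
  "(nat \<Rightarrow> nat \<Rightarrow> real) \<Rightarrow> (nat \<Rightarrow> nat \<Rightarrow> bool) \<Rightarrow> bracket \<Rightarrow> nat \<Rightarrow> real" where
  "score_prod \<phi> d t x = (\<Prod>i\<in>set (entrants t). \<phi> i (score d t x i))"

lemma score_prod_cong:
  assumes "distinct (entrants t)"
    and "\<And>i j. i \<in> set (entrants t) \<Longrightarrow> j \<in> set (entrants t) \<Longrightarrow> i \<noteq> j \<Longrightarrow> d i j = d' i j"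
  shows "score_prod \<phi> d t x = score_prod \<phi> d' t x"
  using winner_cong[OF assms] games_won_cong[OF assms] by (simp add: score_prod_def score_def)

text \<open>
  Once the duel of the two winners is decided, the product over a match splits into one factor
  for each half: this is the pathwise form of the recursion for \<open>score_mean\<close>.
\<close>

lemma score_prod_Match:
  assumes "distinct (entrants (Match a b))"
  shows "score_prod \<phi> d (Match a b) x =
    (if d (winner d a) (winner d b)
     then score_prod \<phi> d a (Suc x) * score_prod \<phi> d b 0
     else score_prod \<phi> d a 0 * score_prod \<phi> d b (Suc x))"
proof -
  have disj: "set (entrants a) \<inter> set (entrants b) = {}" using assms by auto
  have wa: "winner d a \<in> set (entrants a)" and wb: "winner d b \<in> set (entrants b)"
    by (rule winner_in_entrants)+
  have sa: "score d (Match a b) x i = score d a (if d (winner d a) (winner d b) then Suc x else 0) i"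
    if "i \<in> set (entrants a)" for i
    using that disj wb games_won_outside[of i b d] by (auto simp: score_def)
  have sb: "score d (Match a b) x i = score d b (if d (winner d a) (winner d b) then 0 else Suc x) i"
    if "i \<in> set (entrants b)" for i
    using that disj wa games_won_outside[of i a d] by (auto simp: score_def)
  have "score_prod \<phi> d (Match a b) x = (\<Prod>i\<in>set (entrants a). \<phi> i (score d (Match a b) x i)) *
      (\<Prod>i\<in>set (entrants b). \<phi> i (score d (Match a b) x i))"
    using disj by (simp add: score_prod_def prod.union_disjoint)
  then show ?thesis
    using sa sb by (simp add: score_prod_def)
qed

section \<open>Expectations under independent fair duels\<close>

locale fair_tournament = prob_space M for M :: "'w measure" +
  fixes n :: nat and D :: "nat \<Rightarrow> nat \<Rightarrow> 'w \<Rightarrow> bool"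
  assumes fair: "fair_duels M n D"
begin

abbreviation outcome :: "'w \<Rightarrow> nat \<Rightarrow> nat \<Rightarrow> bool" where
  "outcome \<omega> \<equiv> (\<lambda>i j. D i j \<omega>)"

definition pairs :: "nat set \<Rightarrow> (nat \<times> nat) set" where
  "pairs A = {(i, j). i \<in> A \<and> j \<in> A \<and> i < j}"

text \<open>
  Measurability with respect to the duels in \<open>J\<close>, in a form that can be checked without producing
  a function of the results: outcomes that agree on \<open>J\<close> have the same value.
\<close>

definition determined_by :: "(nat \<times> nat) set \<Rightarrow> ('w \<Rightarrow> real) \<Rightarrow> bool" where
  "determined_by J Z \<longleftrightarrow> (\<forall>\<omega>\<in>space M. \<forall>\<omega>'\<in>space M.
     (\<forall>(i, j)\<in>J. D i j \<omega> = D i j \<omega>') \<longrightarrow> Z \<omega> = Z \<omega>')"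

abbreviation results :: "(nat \<times> nat) set \<Rightarrow> 'w \<Rightarrow> nat \<times> nat \<Rightarrow> bool" where
  "results J \<omega> \<equiv> restrict (\<lambda>p. (case p of (i, j) \<Rightarrow> D i j) \<omega>) J"

lemma D_flip: "\<lbrakk>i \<in> {1..n}; j \<in> {1..n}; i \<noteq> j; \<omega> \<in> space M\<rbrakk> \<Longrightarrow> D j i \<omega> \<longleftrightarrow> \<not> D i j \<omega>"
  using fair unfolding fair_duels_def by blast

lemma D_half: "\<lbrakk>i \<in> {1..n}; j \<in> {1..n}; i \<noteq> j\<rbrakk> \<Longrightarrow> prob {\<omega> \<in> space M. D i j \<omega>} = 1 / 2"
  using fair unfolding fair_duels_def by blast

lemma duels_indep:
  "indep_vars (\<lambda>_. count_space UNIV) (\<lambda>p. case p of (i, j) \<Rightarrow> D i j) (pairs {1..n})"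
proof -
  have "pairs {1..n} = {(i, j). 1 \<le> i \<and> i < j \<and> j \<le> n}"
    by (auto simp: pairs_def)
  then show ?thesis using fair by (simp add: fair_duels_def)
qed

lemma finite_pairs: "finite A \<Longrightarrow> finite (pairs A)"
  by (rule finite_subset[of _ "A \<times> A"]) (auto simp: pairs_def)

lemma pairs_mono: "A \<subseteq> B \<Longrightarrow> pairs A \<subseteq> pairs B"
  by (auto simp: pairs_def)

lemma finite_duels: "J \<subseteq> pairs {1..n} \<Longrightarrow> finite J"
  using finite_subset finite_pairs by blast

lemma determined_byD:
  assumes "determined_by J Z" "\<omega> \<in> space M" "\<omega>' \<in> space M"
    and "\<forall>(i, j)\<in>J. D i j \<omega> = D i j \<omega>'"
  shows "Z \<omega> = Z \<omega>'"
  using assms(1)[unfolded determined_by_def, THEN bspec, OF assms(2), THEN bspec, OF assms(3),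
      THEN mp, OF assms(4)] .

text \<open>The converse view: a value determined by \<open>J\<close> can be read off from any point of the sample space
  that shows the same results on \<open>J\<close>.\<close>

lemma determined_by_factor:
  assumes "determined_by J Z"
  obtains g where "\<And>\<omega>. \<omega> \<in> space M \<Longrightarrow> Z \<omega> = g (results J \<omega>)"
proof -
  have "Z \<omega> = Z (SOME \<omega>'. \<omega>' \<in> space M \<and> results J \<omega>' = results J \<omega>)"
    if \<omega>: "\<omega> \<in> space M" for \<omega>
  proof (rule someI2[where a = \<omega> and Q = "\<lambda>\<omega>'. Z \<omega> = Z \<omega>'"])
    fix \<omega>' assume *: "\<omega>' \<in> space M \<and> results J \<omega>' = results J \<omega>"
    have "D i j \<omega> = D i j \<omega>'" if "(i, j) \<in> J" for i j
      using fun_cong[OF conjunct2[OF *], of "(i, j)"] that by simp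
    then have "\<forall>(i, j)\<in>J. D i j \<omega> = D i j \<omega>'" by auto
    then show "Z \<omega> = Z \<omega>'"
      using * \<omega> by (intro determined_byD[OF assms]) auto
  qed (simp add: \<omega>)
  then show thesis by (rule that)
qed

lemma PiM_bool: "finite J \<Longrightarrow>
    PiM J (\<lambda>_. count_space (UNIV :: bool set)) = count_space (PiE J (\<lambda>_. UNIV))"
  by (rule count_space_PiM_finite) simp_all

lemma results_measurable:
  assumes "J \<subseteq> pairs {1..n}"
  shows "results J \<in> measurable M (PiM J (\<lambda>_. count_space UNIV))"
  using assms duels_indep by (intro measurable_restrict) (auto simp: indep_vars_def)

text \<open>There are finitely many possible results on \<open>J\<close>, so every function of them is measurable and
  bounded.\<close>

lemma integrable_determined:
  assumes "determined_by J Z" "J \<subseteq> pairs {1..n}"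
  shows "integrable M Z"
proof -
  obtain g where g: "\<And>\<omega>. \<omega> \<in> space M \<Longrightarrow> Z \<omega> = g (results J \<omega>)"
    using determined_by_factor[OF assms(1)] by blast
  have fin: "finite J" by (rule finite_duels[OF assms(2)])
  have "g \<in> borel_measurable (PiM J (\<lambda>_. count_space UNIV))"
    by (simp add: PiM_bool[OF fin])
  then have "(\<lambda>\<omega>. g (results J \<omega>)) \<in> borel_measurable M"
    by (rule measurable_compose[OF results_measurable[OF assms(2)]])
  then have meas: "Z \<in> borel_measurable M"
    using measurable_cong[of M Z "\<lambda>\<omega>. g (results J \<omega>)" borel] g by blast
  have "bounded (g ` PiE J (\<lambda>_. UNIV))"
    using fin by (intro finite_imp_bounded finite_imageI finite_PiE) auto
  then obtain B where B: "\<And>r. r \<in> PiE J (\<lambda>_. UNIV) \<Longrightarrow> norm (g r) \<le> B"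
    by (auto simp: bounded_iff)
  have "norm (Z \<omega>) \<le> B" if "\<omega> \<in> space M" for \<omega>
    unfolding g[OF that] by (rule B) (simp add: PiE_iff)
  then show ?thesis
    using meas by (intro integrable_const_bound[of _ B]) auto
qed

lemma expectation_mult_determined:
  assumes "determined_by J Y" "determined_by K Z" "J \<inter> K = {}"
    and "J \<subseteq> pairs {1..n}" "K \<subseteq> pairs {1..n}"
  shows "expectation (\<lambda>\<omega>. Y \<omega> * Z \<omega>) = expectation Y * expectation Z"
proof -
  obtain f where f: "\<And>\<omega>. \<omega> \<in> space M \<Longrightarrow> Y \<omega> = f (results J \<omega>)"
    using determined_by_factor[OF assms(1)] by blast
  obtain g where g: "\<And>\<omega>. \<omega> \<in> space M \<Longrightarrow> Z \<omega> = g (results K \<omega>)"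
    using determined_by_factor[OF assms(2)] by blast
  have "indep_var borel (f \<circ> results J) borel (g \<circ> results K)"
    using indep_var_restrict[OF duels_indep assms(3-5)]
    by (rule indep_var_compose) (simp_all add: PiM_bool[OF finite_duels[OF assms(4)]] PiM_bool[OF finite_duels[OF assms(5)]])
  moreover have "integrable M (f \<circ> results J)" "integrable M (g \<circ> results K)"
    using integrable_determined[OF assms(1,4)] integrable_determined[OF assms(2,5)]
    by (simp_all add: f g o_def cong: Bochner_Integration.integrable_cong)
  ultimately have "expectation (\<lambda>\<omega>. (f \<circ> results J) \<omega> * (g \<circ> results K) \<omega>)
      = expectation (f \<circ> results J) * expectation (g \<circ> results K)"
    by (rule indep_var_lebesgue_integral)
  then show ?thesis
    by (simp add: f g o_def cong: Bochner_Integration.integral_cong)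
qed

lemma determined_by_mult:
  assumes "determined_by J Y" "determined_by K Z"
  shows "determined_by (J \<union> K) (\<lambda>\<omega>. Y \<omega> * Z \<omega>)"
  unfolding determined_by_def
proof (intro ballI impI)
  fix \<omega> \<omega>' assume "\<omega> \<in> space M" "\<omega>' \<in> space M" "\<forall>(i, j)\<in>J \<union> K. D i j \<omega> = D i j \<omega>'"
  then have "Y \<omega> = Y \<omega>'" "Z \<omega> = Z \<omega>'"
    by (auto intro: determined_byD[OF assms(1)] determined_byD[OF assms(2)])
  then show "Y \<omega> * Z \<omega> = Y \<omega>' * Z \<omega>'" by simp
qed

text \<open>
  Independence is only available for the duels \<open>(i, j)\<close> with \<open>i < j\<close>, whereas brackets consult
  both orientations. Since the outcome for \<open>(j, i)\<close> is the complement of that for \<open>(i, j)\<close>,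
  the ordered pairs determine both.
\<close>

lemma determined_by_pairsI:
  assumes "A \<subseteq> {1..n}"
    and "\<And>d d'. (\<And>i j. i \<in> A \<Longrightarrow> j \<in> A \<Longrightarrow> i \<noteq> j \<Longrightarrow> d i j = d' i j) \<Longrightarrow> F d = F d'"
  shows "determined_by (pairs A) (\<lambda>\<omega>. F (outcome \<omega>))"
  unfolding determined_by_def
proof (intro ballI impI)
  fix \<omega> \<omega>' assume \<omega>: "\<omega> \<in> space M" "\<omega>' \<in> space M"
    and agree: "\<forall>(i, j)\<in>pairs A. D i j \<omega> = D i j \<omega>'"
  show "F (outcome \<omega>) = F (outcome \<omega>')"
  proof (rule assms(2))
    fix i j assume ij: "i \<in> A" "j \<in> A" "i \<noteq> j"
    show "D i j \<omega> = D i j \<omega>'"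
    proof (cases "i < j")
      case True
      then show ?thesis using ij agree by (auto simp: pairs_def)
    next
      case False
      then have "D j i \<omega> = D j i \<omega>'" using ij agree by (auto simp: pairs_def)
      then show ?thesis using D_flip[of j i] ij assms(1) \<omega> by blast
    qed
  qed
qed

lemma determined_by_duel:
  assumes "i \<in> {1..n}" "j \<in> {1..n}" "i \<noteq> j"
  shows "determined_by (pairs {i, j}) (\<lambda>\<omega>. of_bool (D i j \<omega>))"
proof (rule determined_by_pairsI)
  fix d d' :: "nat \<Rightarrow> nat \<Rightarrow> bool"
  assume "\<And>i' j'. i' \<in> {i, j} \<Longrightarrow> j' \<in> {i, j} \<Longrightarrow> i' \<noteq> j' \<Longrightarrow> d i' j' = d' i' j'"
  from this[of i j] show "of_bool (d i j) = (of_bool (d' i j) :: real)"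
    using assms by simp
qed (use assms in simp)

text \<open>The duels inside \<open>A\<close>, the duels inside \<open>B\<close> and the duel across are three disjoint blocks.\<close>

lemma expectation_duel_mult:
  assumes i: "i \<in> A" and j: "j \<in> B" and AB: "A \<inter> B = {}" "A \<subseteq> {1..n}" "B \<subseteq> {1..n}"
    and Y: "determined_by (pairs A) Y" and Z: "determined_by (pairs B) Z"
  shows "expectation (\<lambda>\<omega>. of_bool (D i j \<omega>) * (Y \<omega> * Z \<omega>)) = expectation Y * expectation Z / 2"
proof -
  have neq: "i \<noteq> j" and mem: "i \<in> {1..n}" "j \<in> {1..n}" using i j AB by auto
  let ?K = "pairs {i, j}"
  have K: "?K \<subseteq> pairs {1..n}" "?K \<inter> (pairs A \<union> pairs B) = {}" "pairs A \<inter> pairs B = {}"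
    using AB i j by (auto simp: pairs_def)
  have sub: "pairs A \<subseteq> pairs {1..n}" "pairs B \<subseteq> pairs {1..n}"
    using AB by (simp_all add: pairs_mono)
  have D: "determined_by ?K (\<lambda>\<omega>. of_bool (D i j \<omega>))"
    by (rule determined_by_duel[OF mem neq])
  have "expectation (\<lambda>\<omega>. of_bool (D i j \<omega>) :: real) = expectation (indicator {\<omega> \<in> space M. D i j \<omega>})"
    by (intro Bochner_Integration.integral_cong) (auto simp: indicator_def)
  also have "\<dots> = prob {\<omega> \<in> space M. D i j \<omega>}"
    by (simp add: Int_absorb2 subset_iff)
  also have "\<dots> = 1 / 2"
    using D_half[OF mem neq] .
  finally have half: "expectation (\<lambda>\<omega>. of_bool (D i j \<omega>) :: real) = 1 / 2" .
  have "expectation (\<lambda>\<omega>. of_bool (D i j \<omega>) * (Y \<omega> * Z \<omega>))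
      = expectation (\<lambda>\<omega>. of_bool (D i j \<omega>)) * expectation (\<lambda>\<omega>. Y \<omega> * Z \<omega>)"
    using sub K by (intro expectation_mult_determined[OF D determined_by_mult[OF Y Z]]) auto
  also have "expectation (\<lambda>\<omega>. Y \<omega> * Z \<omega>) = expectation Y * expectation Z"
    using sub K by (intro expectation_mult_determined[OF Y Z]) auto
  finally show ?thesis using half by simp
qed

abbreviation champion :: "bracket \<Rightarrow> 'w \<Rightarrow> nat" where
  "champion t \<omega> \<equiv> winner (outcome \<omega>) t"

text \<open>Splitting an expectation according to the winner of a bracket; each piece is still
  determined by the duels inside the bracket.\<close>

lemma sum_expectation_champion:
  assumes t: "distinct (entrants t)" "set (entrants t) \<subseteq> {1..n}"
    and Y: "determined_by (pairs (set (entrants t))) Y"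
  shows "(\<Sum>i\<in>set (entrants t). expectation (\<lambda>\<omega>. of_bool (champion t \<omega> = i) * Y \<omega>)) = expectation Y"
    and "determined_by (pairs (set (entrants t))) (\<lambda>\<omega>. of_bool (champion t \<omega> = i) * Y \<omega>)"
proof -
  let ?P = "pairs (set (entrants t))"
  have "determined_by ?P (\<lambda>\<omega>. of_bool (champion t \<omega> = i))" for i
  proof (rule determined_by_pairsI[OF t(2), where F = "\<lambda>d. of_bool (winner d t = i)" for i])
  fix d d' :: "nat \<Rightarrow> nat \<Rightarrow> bool"
  assume "\<And>i j. i \<in> set (entrants t) \<Longrightarrow> j \<in> set (entrants t) \<Longrightarrow> i \<noteq> j \<Longrightarrow> d i j = d' i j"
    then have "winner d t = winner d' t" by (rule winner_cong[OF t(1)])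
    then show "of_bool (winner d t = i) = (of_bool (winner d' t = i) :: real)" for i by simp
  qed
  from determined_by_mult[OF this Y]
  show det: "determined_by ?P (\<lambda>\<omega>. of_bool (champion t \<omega> = i) * Y \<omega>)" for i by simp
  have "expectation Y = expectation (\<lambda>\<omega>. \<Sum>i\<in>set (entrants t). of_bool (champion t \<omega> = i) * Y \<omega>)"
    using winner_in_entrants[of _ t]
    by (intro Bochner_Integration.integral_cong)
      (auto simp: of_bool_def if_distrib[of "\<lambda>c. c * _"] cong: if_cong)
  also have "\<dots> = (\<Sum>i\<in>set (entrants t). expectation (\<lambda>\<omega>. of_bool (champion t \<omega> = i) * Y \<omega>))"
    using integrable_determined[OF det] pairs_mono[OF t(2)]
    by (intro Bochner_Integration.integral_sum) auto
  finally show "(\<Sum>i\<in>set (entrants t). expectation (\<lambda>\<omega>. of_bool (champion t \<omega> = i) * Y \<omega>)) = expectation Y" ..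
qed

text \<open>
  The duel that decides a match is itself random, as it depends on who reaches it. For fixed winners
  \<open>i\<close> and \<open>j\<close> of the two halves it is the single fair duel of \<open>i\<close> against \<open>j\<close>, and the factor
  \<open>1 / 2\<close> is the same for all of them; so it comes out of the sum over \<open>i\<close> and \<open>j\<close>.
\<close>

lemma expectation_final:
  assumes a: "distinct (entrants a)" "set (entrants a) \<subseteq> {1..n}"
    and b: "distinct (entrants b)" "set (entrants b) \<subseteq> {1..n}"
    and disj: "set (entrants a) \<inter> set (entrants b) = {}"
    and Y: "determined_by (pairs (set (entrants a))) Y"
    and Z: "determined_by (pairs (set (entrants b))) Z"
  shows "integrable M (\<lambda>\<omega>. of_bool (D (champion a \<omega>) (champion b \<omega>) \<omega>) * (Y \<omega> * Z \<omega>))"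
    and "expectation (\<lambda>\<omega>. of_bool (D (champion a \<omega>) (champion b \<omega>) \<omega>) * (Y \<omega> * Z \<omega>))
      = expectation Y * expectation Z / 2"
proof -
  let ?A = "set (entrants a)" and ?B = "set (entrants b)"
  let ?Y = "\<lambda>i \<omega>. of_bool (champion a \<omega> = i) * Y \<omega>"
  let ?Z = "\<lambda>j \<omega>. of_bool (champion b \<omega> = j) * Z \<omega>"
  let ?T = "\<lambda>i j \<omega>. of_bool (D i j \<omega>) * (?Y i \<omega> * ?Z j \<omega>)"
  note detY = sum_expectation_champion(2)[OF a Y] and detZ = sum_expectation_champion(2)[OF b Z]
  have split: "of_bool (D (champion a \<omega>) (champion b \<omega>) \<omega>) * (Y \<omega> * Z \<omega>)
      = (\<Sum>i\<in>?A. \<Sum>j\<in>?B. ?T i j \<omega>)" for \<omega>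
  proof -
    have "(\<Sum>j\<in>?B. ?T i j \<omega>) = (\<Sum>j\<in>?B. if champion b \<omega> = j then ?T i j \<omega> else 0)" for i
      by (intro sum.cong) auto
    then have "(\<Sum>j\<in>?B. ?T i j \<omega>) = ?T i (champion b \<omega>) \<omega>" for i
      by (simp only: sum.delta' finite_set winner_in_entrants if_True)
    moreover have "(\<Sum>i\<in>?A. ?T i (champion b \<omega>) \<omega>)
        = (\<Sum>i\<in>?A. if champion a \<omega> = i then ?T i (champion b \<omega>) \<omega> else 0)"
      by (intro sum.cong) auto
    then have "(\<Sum>i\<in>?A. ?T i (champion b \<omega>) \<omega>) = ?T (champion a \<omega>) (champion b \<omega>) \<omega>"
      by (simp only: sum.delta' finite_set winner_in_entrants if_True)
    ultimately show ?thesis by simp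
  qed
  have int: "integrable M (?T i j)" if "i \<in> ?A" "j \<in> ?B" for i j
  proof (rule integrable_determined)
    show "determined_by (pairs {i, j} \<union> (pairs ?A \<union> pairs ?B)) (?T i j)"
      using that a b disj by (intro determined_by_mult determined_by_duel detY detZ) auto
    show "pairs {i, j} \<union> (pairs ?A \<union> pairs ?B) \<subseteq> pairs {1..n}"
      using that a b by (auto simp: pairs_def)
  qed
  show "integrable M (\<lambda>\<omega>. of_bool (D (champion a \<omega>) (champion b \<omega>) \<omega>) * (Y \<omega> * Z \<omega>))"
    unfolding split by (intro Bochner_Integration.integrable_sum int)
  have "expectation (\<lambda>\<omega>. of_bool (D (champion a \<omega>) (champion b \<omega>) \<omega>) * (Y \<omega> * Z \<omega>))
      = (\<Sum>i\<in>?A. expectation (\<lambda>\<omega>. \<Sum>j\<in>?B. ?T i j \<omega>))"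
    unfolding split
    by (intro Bochner_Integration.integral_sum Bochner_Integration.integrable_sum int)
  also have "\<dots> = (\<Sum>i\<in>?A. \<Sum>j\<in>?B. expectation (?T i j))"
    by (intro sum.cong refl Bochner_Integration.integral_sum int)
  also have "\<dots> = (\<Sum>i\<in>?A. \<Sum>j\<in>?B. expectation (?Y i) * expectation (?Z j) / 2)"
    by (intro sum.cong refl expectation_duel_mult[OF _ _ disj a(2) b(2) detY detZ])
  also have "\<dots> = (\<Sum>i\<in>?A. expectation (?Y i)) * (\<Sum>j\<in>?B. expectation (?Z j)) / 2"
    by (simp add: sum_product sum_divide_distrib)
  finally show "expectation (\<lambda>\<omega>. of_bool (D (champion a \<omega>) (champion b \<omega>) \<omega>) * (Y \<omega> * Z \<omega>))
      = expectation Y * expectation Z / 2"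
    by (simp add: sum_expectation_champion(1)[OF a Y] sum_expectation_champion(1)[OF b Z])
qed

lemma determined_by_score_prod:
  assumes "distinct (entrants t)" "set (entrants t) \<subseteq> {1..n}"
  shows "determined_by (pairs (set (entrants t))) (\<lambda>\<omega>. score_prod \<phi> (outcome \<omega>) t x)"
proof (rule determined_by_pairsI[OF assms(2), where F = "\<lambda>d. score_prod \<phi> d t x"])
  fix d d' :: "nat \<Rightarrow> nat \<Rightarrow> bool"
  assume "\<And>i j. i \<in> set (entrants t) \<Longrightarrow> j \<in> set (entrants t) \<Longrightarrow> i \<noteq> j \<Longrightarrow> d i j = d' i j"
  then show "score_prod \<phi> d t x = score_prod \<phi> d' t x"
    by (rule score_prod_cong[OF assms(1)])
qed

theorem expectation_score_prod:
  assumes "distinct (entrants t)" "set (entrants t) \<subseteq> {1..n}"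
  shows "expectation (\<lambda>\<omega>. score_prod \<phi> (outcome \<omega>) t x) = score_mean t \<phi> x"
  using assms
proof (induction t arbitrary: x)
  case (Player i)
  show ?case by (simp add: score_prod_def score_def prob_space)
next
  case (Match a b)
  have a: "distinct (entrants a)" "set (entrants a) \<subseteq> {1..n}"
    and b: "distinct (entrants b)" "set (entrants b) \<subseteq> {1..n}"
    and disj: "set (entrants a) \<inter> set (entrants b) = {}"
    using Match.prems by auto
  let ?Y = "\<lambda>x \<omega>. score_prod \<phi> (outcome \<omega>) a x" and ?Z = "\<lambda>x \<omega>. score_prod \<phi> (outcome \<omega>) b x"
  let ?U = "\<lambda>\<omega>. of_bool (D (champion a \<omega>) (champion b \<omega>) \<omega>) * (?Y (Suc x) \<omega> * ?Z 0 \<omega>)"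
  let ?V = "\<lambda>\<omega>. of_bool (D (champion b \<omega>) (champion a \<omega>) \<omega>) * (?Z (Suc x) \<omega> * ?Y 0 \<omega>)"
  note U = expectation_final[OF a b disj determined_by_score_prod[OF a] determined_by_score_prod[OF b]]
  have disj': "set (entrants b) \<inter> set (entrants a) = {}" using disj by auto
  note V = expectation_final[OF b a disj' determined_by_score_prod[OF b] determined_by_score_prod[OF a]]
  have "expectation (\<lambda>\<omega>. score_prod \<phi> (outcome \<omega>) (Match a b) x) = expectation (\<lambda>\<omega>. ?U \<omega> + ?V \<omega>)"
  proof (rule Bochner_Integration.integral_cong[OF refl])
    fix \<omega> assume "\<omega> \<in> space M"
    moreover have "champion a \<omega> \<in> {1..n}" "champion b \<omega> \<in> {1..n}" "champion a \<omega> \<noteq> champion b \<omega>"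
      using a b disj winner_in_entrants[of "outcome \<omega>" a] winner_in_entrants[of "outcome \<omega>" b]
      by auto
    ultimately have "D (champion b \<omega>) (champion a \<omega>) \<omega> \<longleftrightarrow> \<not> D (champion a \<omega>) (champion b \<omega>) \<omega>"
      by (intro D_flip)
    then show "score_prod \<phi> (outcome \<omega>) (Match a b) x = ?U \<omega> + ?V \<omega>"
      by (simp add: score_prod_Match[OF Match.prems(1)])
  qed
  also have "\<dots> = expectation ?U + expectation ?V"
    by (intro Bochner_Integration.integral_add U V)
  also have "\<dots> = score_mean (Match a b) \<phi> x"
    by (simp only: U(2) V(2) Match.IH(1)[OF a] Match.IH(2)[OF b] score_mean.simps)
      (simp add: field_simps)
  finally show ?case .
qed

text \<open>
  The product inequality for indicators, with no further rounds to come. Upward closed conditions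
  \<open>P i\<close> are monotone as maps into the truth values, downward closed ones antimonotone.
\<close>

theorem monotone_scores_le_prod:
  assumes t: "distinct (entrants t)" "set (entrants t) \<subseteq> {1..n}"
    and P: "(\<forall>i. mono (P i)) \<or> (\<forall>i. antimono (P i))"
  shows "prob {\<omega> \<in> space M. \<forall>i\<in>set (entrants t). P i (games_won (outcome \<omega>) t i)}
    \<le> (\<Prod>i\<in>set (entrants t). prob {\<omega> \<in> space M. P i (games_won (outcome \<omega>) t i)})"
proof -
  define \<phi> where "\<phi> = (\<lambda>i m. of_bool (P i m) :: real)"
  have \<phi>: "(\<forall>i. mono (\<phi> i)) \<or> (\<forall>i. antimono (\<phi> i))"
    using P by (auto simp: \<phi>_def monotone_def le_bool_def)
  \<comment> \<open>Used for \<open>P\<close>, and for the condition on a single player that gives a marginal.\<close>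
  have prob_eq: "prob {\<omega> \<in> space M. \<forall>i\<in>set (entrants t). Q i (games_won (outcome \<omega>) t i)}
      = score_mean t (\<lambda>i m. of_bool (Q i m)) 0" for Q
  proof -
    let ?E = "{\<omega> \<in> space M. \<forall>i\<in>set (entrants t). Q i (games_won (outcome \<omega>) t i)}"
    have "prob ?E = expectation (indicator ?E)"
      by (simp add: Int_absorb2 subset_iff)
    also have "\<dots> = expectation (\<lambda>\<omega>. score_prod (\<lambda>i m. of_bool (Q i m)) (outcome \<omega>) t 0)"
      by (intro Bochner_Integration.integral_cong refl)
        (auto simp: indicator_def score_prod_def score_def)
    finally show ?thesis using expectation_score_prod[OF t] by simp
  qed
  have "prob {\<omega> \<in> space M. \<forall>i\<in>set (entrants t). P i (games_won (outcome \<omega>) t i)}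
      = mean_gain 0 (score_mean t \<phi>)"
    by (simp add: prob_eq \<phi>_def)
  also have "\<dots> \<le> (\<Prod>i\<in>set (entrants t). mean_gain 0 (score_mean t (only i \<phi>)))"
    by (rule mean_gain_score_mean_le_prod[OF _ \<phi> t(1)]) (simp add: \<phi>_def)
  also have "\<dots> = (\<Prod>i\<in>set (entrants t). prob {\<omega> \<in> space M. P i (games_won (outcome \<omega>) t i)})"
  proof (rule prod.cong[OF refl])
    fix i assume i: "i \<in> set (entrants t)"
    have "only i \<phi> = (\<lambda>j m. of_bool (j = i \<longrightarrow> P j m))"
      by (auto simp: \<phi>_def fun_eq_iff)
    then show "mean_gain 0 (score_mean t (only i \<phi>))
        = prob {\<omega> \<in> space M. P i (games_won (outcome \<omega>) t i)}"
      using prob_eq[of "\<lambda>j m. j = i \<longrightarrow> P j m"] i by (simp cong: conj_cong)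
  qed
  finally show ?thesis .
qed

lemma games_won_measurable:
  assumes t: "distinct (entrants t)" "set (entrants t) \<subseteq> {1..n}"
  shows "(\<lambda>\<omega>. real (games_won (outcome \<omega>) t i)) \<in> borel_measurable M"
proof -
  have "determined_by (pairs (set (entrants t))) (\<lambda>\<omega>. real (games_won (outcome \<omega>) t i))"
  proof (rule determined_by_pairsI[OF t(2), where F = "\<lambda>d. real (games_won d t i)"])
  fix d d' :: "nat \<Rightarrow> nat \<Rightarrow> bool"
  assume "\<And>i j. i \<in> set (entrants t) \<Longrightarrow> j \<in> set (entrants t) \<Longrightarrow> i \<noteq> j \<Longrightarrow> d i j = d' i j"
    then have "games_won d t = games_won d' t" by (rule games_won_cong[OF t(1)])
    then show "real (games_won d t i) = real (games_won d' t i)" by simp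
  qed
  from integrable_determined[OF this pairs_mono[OF t(2)]] show ?thesis by simp
qed

end

theorem proposition3p2:
  fixes M :: "'w measure" and l n :: nat and b :: bracket
    and D :: "nat \<Rightarrow> nat \<Rightarrow> 'w \<Rightarrow> bool" and S :: "nat \<Rightarrow> 'w \<Rightarrow> real"
  assumes "prob_space M"
    and "n = 2 ^ l"
    and "knockout_draw l b"
    and "fair_duels M n D"
    and "\<And>i \<omega>. S i \<omega> = real (games_won (\<lambda>j k. D j k \<omega>) b i)"
  shows "negatively_orthant_dependent M {1..n} S"
proof -
  interpret prob_space M by fact
  interpret fair_tournament M n D by unfold_locales fact
  have players: "set (entrants b) = {1..n}" and b: "distinct (entrants b)" "set (entrants b) \<subseteq> {1..n}"
    using assms(2,3) by (auto simp: knockout_draw_def)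
  have S: "S = (\<lambda>i \<omega>. real (games_won (\<lambda>j k. D j k \<omega>) b i))"
    using assms(5) by blast
  show ?thesis
    unfolding negatively_orthant_dependent_def S
  proof (intro conjI ballI allI)
    show "(\<lambda>\<omega>. real (games_won (\<lambda>j k. D j k \<omega>) b i)) \<in> borel_measurable M" for i
      by (rule games_won_measurable[OF b])
    fix s :: "nat \<Rightarrow> real"
    have "\<forall>i. antimono (\<lambda>m. real m \<le> s i)"
      by (auto simp: monotone_def le_bool_def)
    then show "prob {\<omega> \<in> space M. \<forall>i\<in>{1..n}. real (games_won (\<lambda>j k. D j k \<omega>) b i) \<le> s i}
        \<le> (\<Prod>i\<in>{1..n}. prob {\<omega> \<in> space M. real (games_won (\<lambda>j k. D j k \<omega>) b i) \<le> s i})"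
      using monotone_scores_le_prod[OF b, of "\<lambda>i m. real m \<le> s i"] by (simp add: players)
    have "\<forall>i. mono (\<lambda>m. real m > s i)"
      by (auto simp: monotone_def le_bool_def)
    then show "prob {\<omega> \<in> space M. \<forall>i\<in>{1..n}. real (games_won (\<lambda>j k. D j k \<omega>) b i) > s i}
        \<le> (\<Prod>i\<in>{1..n}. prob {\<omega> \<in> space M. real (games_won (\<lambda>j k. D j k \<omega>) b i) > s i})"
      using monotone_scores_le_prod[OF b, of "\<lambda>i m. real m > s i"] by (simp add: players)
  qed
qed

end
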